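(* Let $A$ and $B$ be two positive bounded operators on a complex Hilbert space $\mathscr{H}$. Suppose that, for some positive integers $n_0$ and $m_0$ respectively, the sets $\mathcal{K}_{n_0,A,B}$ and $\mathcal{K}_{m_0,B,A}$ are nonempty and each of them is either compact in the strong operator topology or closed in the weak operator topology. Then $A$ and $B$ are unitarily equivalent.
   Context: Let $\mathbb{B}(\mathscr{H})$ be the algebra of bounded linear operators on $\mathscr{H}$ and $\mathcal{U}(\mathscr{H})$ the set of unitary operators in it. For bounded self-adjoint $S,T$, $S\leq T$ means that $\langle (T-S)x,x\rangle\geq 0$ for all $x\in\mathscr{H}$; an operator $A$ is positive if $A\geq 0$. For positive operators $C,D\in\mathbb{B}(\mathscr{H})$ and a positive integer $n$, define $\mathcal{K}_{n,C,D}=\{U\in\mathcal{U}(\mathscr{H}): C^n\leq U^*D^nU\}$. Compactness and closedness are those of these sets as subsets of $\mathbb{B}(\mathscr{H})$ with the indicated topology. $A$ and $B$ are unitarily equivalent if $A=W^*BW$ for some $W\in\mathcal{U}(\mathscr{H})$. *)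

theory Defs
  imports "HOL-Analysis.Analysis" "HOL-Library.Nonpos_Ints"
begin

section \<open>Complex Hilbert spaces\<close>

text \<open>
  The inner product is linear in the first argument. The library classes only know real
  scalars; the complex scalar multiplication extends the real one of the underlying Banach
  space, whose norm is the one given by the inner product. No dimension or separability
  restriction is made.
\<close>

class complex_hilbert_space = banach +
  fixes scaleC :: "complex \<Rightarrow> 'a \<Rightarrow> 'a" (infixr "*\<^sub>C" 75)
    and cinner :: "'a \<Rightarrow> 'a \<Rightarrow> complex"
  assumes scaleC_add_right: "a *\<^sub>C (x + y) = a *\<^sub>C x + a *\<^sub>C y"
    and scaleC_add_left: "(a + b) *\<^sub>C x = a *\<^sub>C x + b *\<^sub>C x"
    and scaleC_scaleC: "a *\<^sub>C (b *\<^sub>C x) = (a * b) *\<^sub>C x"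
    and scaleC_of_real: "complex_of_real r *\<^sub>C x = r *\<^sub>R x"
    and cinner_commute: "cinner x y = cnj (cinner y x)"
    and cinner_add_left: "cinner (x + y) z = cinner x z + cinner y z"
    and cinner_scaleC_left: "cinner (a *\<^sub>C x) y = a * cinner x y"
    and cinner_self: "cinner x x = complex_of_real ((norm x)\<^sup>2)"

instantiation complex :: complex_hilbert_space
begin

definition scaleC_complex :: "complex \<Rightarrow> complex \<Rightarrow> complex" where
  "scaleC_complex a x = a * x"

definition cinner_complex :: "complex \<Rightarrow> complex \<Rightarrow> complex" where
  "cinner_complex x y = x * cnj y"

instance
proof
  fix x :: complex
  show "cinner x x = complex_of_real ((norm x)\<^sup>2)"
    unfolding cinner_complex_def by (metis complex_norm_square)
qed (auto simp: scaleC_complex_def cinner_complex_def algebra_simps scaleR_conv_of_real)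

end

lemma cinner_add_right:
  "cinner (x::'a::complex_hilbert_space) (y + z) = cinner x y + cinner x z"
  by (metis cinner_add_left cinner_commute complex_cnj_add)

lemma cinner_scaleC_right:
  "cinner (x::'a::complex_hilbert_space) (a *\<^sub>C y) = cnj a * cinner x y"
  by (metis cinner_scaleC_left cinner_commute complex_cnj_mult)

lemma cinner_scaleR_left:
  "cinner (r *\<^sub>R (x::'a::complex_hilbert_space)) y = complex_of_real r * cinner x y"
  by (metis cinner_scaleC_left scaleC_of_real)

lemma cinner_scaleR_right:
  "cinner (x::'a::complex_hilbert_space) (r *\<^sub>R y) = complex_of_real r * cinner x y"
  by (metis cinner_scaleC_right scaleC_of_real complex_cnj_complex_of_real)

lemma cinner_minus_left:
  "cinner (- (x::'a::complex_hilbert_space)) y = - cinner x y"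
  using cinner_scaleR_left[of "-1" x y] by simp

lemma cinner_minus_right:
  "cinner (x::'a::complex_hilbert_space) (- y) = - cinner x y"
  using cinner_scaleR_right[of x "-1" y] by simp

lemma cinner_diff_left:
  "cinner ((x::'a::complex_hilbert_space) - y) z = cinner x z - cinner y z"
  using cinner_add_left[of x "- y" z] by (simp add: cinner_minus_left)

lemma cinner_diff_right:
  "cinner (x::'a::complex_hilbert_space) (y - z) = cinner x y - cinner x z"
  using cinner_add_right[of x y "- z"] by (simp add: cinner_minus_right)

lemma norm_add_square:
  "(norm ((x::'a::complex_hilbert_space) + y))\<^sup>2
     = (norm x)\<^sup>2 + 2 * Re (cinner x y) + (norm y)\<^sup>2"
proof -
  have "complex_of_real ((norm (x + y))\<^sup>2)
      = cinner x x + cinner x y + cinner y x + cinner y y"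
    by (simp add: cinner_self[symmetric] cinner_add_left cinner_add_right del: of_real_power)
  then have "(norm (x + y))\<^sup>2
      = Re (cinner x x) + Re (cinner x y) + Re (cinner y x) + Re (cinner y y)"
    by (metis Re_complex_of_real plus_complex.simps(1))
  moreover have "Re (cinner y x) = Re (cinner x y)"
    by (metis cinner_commute complex_cnj(1) cnj.simps(1))
  ultimately show ?thesis
    by (simp add: cinner_self del: of_real_power)
qed

lemma cinner_cauchy_schwarz_Re:
  "\<bar>Re (cinner (x::'a::complex_hilbert_space) y)\<bar> \<le> norm x * norm y"
proof -
  have *: "Re (cinner u v) \<le> norm u * norm v" for u v :: 'a
  proof -
    have "(norm (u + v))\<^sup>2 \<le> (norm u + norm v)\<^sup>2"
      by (intro power_mono norm_triangle_ineq) auto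
    then show ?thesis
      unfolding norm_add_square by (simp add: power2_sum)
  qed
  show ?thesis
    using *[of x y] *[of "- x" y] by (auto simp: cinner_minus_left abs_le_iff)
qed

lemma cinner_eqI:
  assumes "\<And>x. cinner x y = cinner x (z::'a::complex_hilbert_space)"
  shows "y = z"
proof -
  have "cinner (y - z) (y - z) = 0"
    using assms[of "y - z"] by (simp add: cinner_diff_right)
  then show ?thesis
    by (simp add: cinner_self)
qed

section \<open>The algebra of bounded operators\<close>

text \<open>
  The type of bounded linear functions of the library consists of the real-linear maps;
  \<open>B(H)\<close> is the set of those that are complex-linear.
\<close>

definition bounded_operators :: "('a::complex_hilbert_space \<Rightarrow>\<^sub>L 'a) set" where
  "bounded_operators = {T. \<forall>c x. blinfun_apply T (c *\<^sub>C x) = c *\<^sub>C blinfun_apply T x}"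

definition adj :: "('a::complex_hilbert_space \<Rightarrow>\<^sub>L 'a) \<Rightarrow> ('a \<Rightarrow>\<^sub>L 'a)" where
  "adj T = (THE S. S \<in> bounded_operators \<and> (\<forall>x y. cinner (T x) y = cinner x (blinfun_apply S y)))"

lemma riesz_real:
  fixes f :: "'a::complex_hilbert_space \<Rightarrow> real"
  assumes f: "bounded_linear f"
  shows "\<exists>z. \<forall>x. f x = Re (cinner x z)"
proof -
  interpret f: bounded_linear f by (rule f)
  obtain M where M: "\<And>x. norm (f x) \<le> norm x * M"
    using f.bounded by blast
  define q where "q x = (norm x)\<^sup>2 - 2 * f x" for x
  have lower: "- M\<^sup>2 \<le> q x" for x
  proof -
    have "2 * f x \<le> 2 * norm x * M"
      using M[of x] by simp
    moreover have "0 \<le> (norm x - M)\<^sup>2"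
      by simp
    ultimately show ?thesis
      by (simp add: q_def power2_diff)
  qed
  define m where "m = Inf (range q)"
  have bdd: "bdd_below (range q)"
    using lower by (auto intro!: bdd_belowI)
  have m_le: "m \<le> q x" for x
    unfolding m_def by (rule cInf_lower[OF _ bdd]) auto
  have "\<exists>x. q x < m + inverse (real (Suc n))" for n
    using cInf_lessD[of "range q" "m + inverse (real (Suc n))"] by (auto simp: m_def)
  then obtain X where X: "\<And>n. q (X n) < m + inverse (real (Suc n))"
    by metis
  have par: "(norm (x - y))\<^sup>2 \<le> 2 * (q x - m) + 2 * (q y - m)" for x y
  proof -
    have "q ((1/2) *\<^sub>R (x + y)) = (norm (x + y))\<^sup>2 / 4 - (f x + f y)"
      unfolding q_def f.scaleR f.add by (simp add: power_divide add_divide_distrib)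
    moreover have "(norm (x + y))\<^sup>2 + (norm (x - y))\<^sup>2 = 2 * (norm x)\<^sup>2 + 2 * (norm y)\<^sup>2"
      using norm_add_square[of x y] norm_add_square[of x "- y"]
      by (simp add: cinner_minus_right)
    ultimately show ?thesis
      using m_le[of "(1/2) *\<^sub>R (x + y)"] by (simp add: q_def)
  qed
  have "Cauchy X"
  proof (rule metric_CauchyI)
    fix e :: real assume "0 < e"
    then obtain N where N: "inverse (real (Suc N)) < e\<^sup>2 / 4"
      using reals_Archimedean[of "e\<^sup>2 / 4"] by auto
    have small: "q (X n) - m < e\<^sup>2 / 4" if "n \<ge> N" for n
    proof -
      have "inverse (real (Suc n)) \<le> inverse (real (Suc N))"
        using that by (simp add: field_simps)
      then show ?thesis
        using X[of n] N by linarith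
    qed
    have "dist (X i) (X j) < e" if "i \<ge> N" "j \<ge> N" for i j
    proof -
      have "(norm (X i - X j))\<^sup>2 < e\<^sup>2"
        using par[of "X i" "X j"] small[OF that(1)] small[OF that(2)]
        by (simp add: field_simps)
      then show ?thesis
        using \<open>0 < e\<close> by (simp add: dist_norm power2_less_imp_less)
    qed
    then show "\<exists>N. \<forall>i\<ge>N. \<forall>j\<ge>N. dist (X i) (X j) < e"
      by blast
  qed
  then obtain z where z: "X \<longlonglongrightarrow> z"
    using Cauchy_convergent convergent_def by blast
  have "(\<lambda>n. q (X n)) \<longlonglongrightarrow> q z"
    unfolding q_def by (intro tendsto_intros z f.tendsto)
  moreover have "(\<lambda>n. m + inverse (real (Suc n))) \<longlonglongrightarrow> m"
    using LIMSEQ_inverse_real_of_nat_add by blast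
  ultimately have "q z \<le> m"
    by (rule LIMSEQ_le) (use X less_imp_le in blast)
  then have min: "q z \<le> q x" for x
    using m_le[of x] by linarith
  have "f x = Re (cinner x z)" for x
  proof (cases "x = 0")
    case True
    have "cinner 0 z = 0"
      using cinner_scaleR_left[of 0 x z] by simp
    then show ?thesis using True by (simp add: f.zero)
  next
    case False
    define b where "b = Re (cinner x z) - f x"
    define t where "t = - b / (norm x)\<^sup>2"
    have nz: "(norm x)\<^sup>2 > 0"
      using False by simp
    have "q (t *\<^sub>R x + z) = q z + t\<^sup>2 * (norm x)\<^sup>2 + 2 * t * b"
      unfolding q_def norm_add_square f.add f.scaleR b_def
      by (simp add: cinner_scaleR_left power_mult_distrib algebra_simps)
    then have "0 \<le> t\<^sup>2 * (norm x)\<^sup>2 + 2 * t * b"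
      using min[of "t *\<^sub>R x + z"] by linarith
    also have "\<dots> = - (b\<^sup>2 / (norm x)\<^sup>2)"
      using nz by (simp add: t_def power2_eq_square field_simps)
    finally have "b\<^sup>2 \<le> 0"
      using nz by (simp add: divide_le_0_iff)
    then show ?thesis
      by (simp add: b_def)
  qed
  then show ?thesis by blast
qed

lemma adjoint_unique:
  fixes S R T :: "'a::complex_hilbert_space \<Rightarrow>\<^sub>L 'a"
  assumes "\<forall>x y. cinner (T x) y = cinner x (S y)" "\<forall>x y. cinner (T x) y = cinner x (R y)"
  shows "S = R"
proof (rule blinfun_eqI)
  fix y
  show "S y = R y"
    by (rule cinner_eqI) (rule trans[OF assms(1)[rule_format, symmetric] assms(2)[rule_format]])
qed

lemma adjoint_exists:
  fixes T :: "'a::complex_hilbert_space \<Rightarrow>\<^sub>L 'a"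
  assumes T: "T \<in> bounded_operators"
  shows "\<exists>S. S \<in> bounded_operators \<and> (\<forall>x y. cinner (T x) y = cinner x (blinfun_apply S y))"
proof -
  have lin: "bounded_linear (\<lambda>x. Re (cinner (T x) y))" for y
  proof (rule bounded_linear_intro[where K = "norm T * norm y"])
    fix x
    have "norm (Re (cinner (T x) y)) \<le> norm (T x) * norm y"
      using cinner_cauchy_schwarz_Re by simp
    also have "\<dots> \<le> norm x * (norm T * norm y)"
      using mult_right_mono[OF norm_blinfun[of T x], of "norm y"] by (simp add: ac_simps)
    finally show "norm (Re (cinner (T x) y)) \<le> norm x * (norm T * norm y)" .
  qed (simp_all add: blinfun.add_right blinfun.scaleR_right cinner_add_left cinner_scaleR_left)
  obtain s where s: "\<And>x y. Re (cinner (T x) y) = Re (cinner x (s y))"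
    using riesz_real[OF lin] by metis
  have adj: "cinner (T x) y = cinner x (s y)" for x y
  proof (rule complex_eqI)
    have Im: "Im w = - Re (\<i> * w)" for w
      by simp
    show "Im (cinner (T x) y) = Im (cinner x (s y))"
      unfolding Im cinner_scaleC_left[symmetric]
      using s[of "\<i> *\<^sub>C x" y] T by (simp add: bounded_operators_def)
  qed (rule s)
  have add: "s (x + y) = s x + s y" for x y
    by (rule cinner_eqI) (simp add: cinner_add_right adj[symmetric])
  have scC: "s (c *\<^sub>C x) = c *\<^sub>C s x" for c x
    by (rule cinner_eqI) (simp add: cinner_scaleC_right adj[symmetric])
  have "bounded_linear s"
  proof (rule bounded_linear_intro[where K = "norm T"])
    fix y
    have "(norm (s y))\<^sup>2 = Re (cinner (T (s y)) y)"
      unfolding adj cinner_self by simp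
    also have "\<dots> \<le> norm (T (s y)) * norm y"
      using cinner_cauchy_schwarz_Re[of "T (s y)" y] by linarith
    also have "\<dots> \<le> norm T * norm (s y) * norm y"
      by (intro mult_right_mono norm_blinfun) auto
    finally have "norm (s y) * norm (s y) \<le> norm (s y) * (norm y * norm T)"
      by (simp add: power2_eq_square ac_simps)
    then show "norm (s y) \<le> norm y * norm T"
      by (cases "norm (s y) = 0") (auto simp: mult_le_cancel_left)
  next
    show "s (r *\<^sub>R x) = r *\<^sub>R s x" for r x
      using scC[of "complex_of_real r" x] by (simp add: scaleC_of_real)
  qed (rule add)
  then have ap: "blinfun_apply (Blinfun s) = s"
    by (rule bounded_linear_Blinfun_apply)
  show ?thesis
    by (rule exI[of _ "Blinfun s"]) (auto simp: bounded_operators_def ap adj scC)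
qed

lemma adj_spec:
  assumes "T \<in> bounded_operators"
  shows "adj T \<in> bounded_operators" "cinner (T x) y = cinner x (adj T y)"
proof -
  have "\<exists>!S. S \<in> bounded_operators \<and> (\<forall>x y. cinner (T x) y = cinner x (blinfun_apply S y))"
    using adjoint_exists[OF assms]
    by (rule ex_ex1I) (elim conjE, rule adjoint_unique)
  note * = theI'[OF this, folded adj_def]
  show "adj T \<in> bounded_operators"
    using * by (rule conjunct1)
  show "cinner (T x) y = cinner x (adj T y)"
    using conjunct2[OF *] by (elim allE)
qed

definition selfadjoint :: "('a::complex_hilbert_space \<Rightarrow>\<^sub>L 'a) \<Rightarrow> bool" where
  "selfadjoint T \<longleftrightarrow> T \<in> bounded_operators \<and> adj T = T"

text \<open>
  The order is a relation between bounded self-adjoint operators; \<open>\<real>\<^sub>\<ge>\<^sub>0\<close> is the set of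
  nonnegative real numbers inside the complex numbers.
\<close>

definition op_le :: "('a::complex_hilbert_space \<Rightarrow>\<^sub>L 'a) \<Rightarrow> ('a \<Rightarrow>\<^sub>L 'a) \<Rightarrow> bool" where
  "op_le S T \<longleftrightarrow> selfadjoint S \<and> selfadjoint T \<and> (\<forall>x. cinner ((T - S) x) x \<in> \<real>\<^sub>\<ge>\<^sub>0)"

definition positive_operator :: "('a::complex_hilbert_space \<Rightarrow>\<^sub>L 'a) \<Rightarrow> bool" where
  "positive_operator A \<longleftrightarrow> op_le 0 A"

definition unitary_operators :: "('a::complex_hilbert_space \<Rightarrow>\<^sub>L 'a) set" where
  "unitary_operators =
     {U \<in> bounded_operators. adj U o\<^sub>L U = id_blinfun \<and> U o\<^sub>L adj U = id_blinfun}"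

definition op_power :: "('a::complex_hilbert_space \<Rightarrow>\<^sub>L 'a) \<Rightarrow> nat \<Rightarrow> ('a \<Rightarrow>\<^sub>L 'a)" where
  "op_power T n = (((o\<^sub>L) T) ^^ n) id_blinfun"

definition unitarily_equivalent ::
    "('a::complex_hilbert_space \<Rightarrow>\<^sub>L 'a) \<Rightarrow> ('a \<Rightarrow>\<^sub>L 'a) \<Rightarrow> bool" where
  "unitarily_equivalent A B \<longleftrightarrow> (\<exists>W\<in>unitary_operators. A = adj W o\<^sub>L B o\<^sub>L W)"

definition K_set ::
    "nat \<Rightarrow> ('a::complex_hilbert_space \<Rightarrow>\<^sub>L 'a) \<Rightarrow> ('a \<Rightarrow>\<^sub>L 'a) \<Rightarrow> ('a \<Rightarrow>\<^sub>L 'a) set" where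
  "K_set n C D =
     {U \<in> unitary_operators. op_le (op_power C n) (adj U o\<^sub>L op_power D n o\<^sub>L U)}"

section \<open>Operator topologies on the algebra of bounded operators\<close>

text \<open>
  Both are the initial topologies, relativised to \<open>B(H)\<close>: the strong one for the evaluations
  \<open>T \<mapsto> T x\<close> and the weak one for the matrix coefficients \<open>T \<mapsto> \<langle>T x, y\<rangle>\<close>.
\<close>

definition SOT :: "('a::complex_hilbert_space \<Rightarrow>\<^sub>L 'a) topology" where
  "SOT = subtopology strong_operator_topology bounded_operators"

definition WOT :: "('a::complex_hilbert_space \<Rightarrow>\<^sub>L 'a) topology" where
  "WOT = pullback_topology bounded_operators (\<lambda>T (x, y). cinner (blinfun_apply T x) y) euclidean"

end

theory Submission
  imports Defs
begin

text \<open>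
  By the Loewner--Heinz inequality for integer powers, \<open>C\<^sup>n \<le> D\<^sup>n\<close> implies \<open>C\<^sup>k \<le> D\<^sup>k\<close> for
  \<open>k \<le> n\<close>. By symmetry let \<open>p = m\<^sub>0 \<le> n\<^sub>0\<close>, so that there are unitaries with
  \<open>A\<^sup>p \<le> U\<^sup>* B\<^sup>p U\<close> and \<open>B\<^sup>p \<le> V\<^sup>* A\<^sup>p V\<close>. Put \<open>W = V U\<close>. Then \<open>A\<^sup>p \<le> W\<^sup>* A\<^sup>p W\<close>, and all
  \<open>W\<^sup>k V\<close> lie in \<open>K\<^sub>p(B, A)\<close>. Either topological hypothesis yields a cluster point of this
  sequence that is again unitary, hence a strong cluster point \<open>X\<close> of \<open>W\<^sup>k\<close> which is unitary and
  commutes with \<open>W\<close>. Comparing limits of the increasing forms of \<open>(W\<^sup>k)\<^sup>* A\<^sup>p W\<^sup>k\<close> gives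
  \<open>A\<^sup>p = W\<^sup>* A\<^sup>p W\<close>, which forces \<open>A\<^sup>p = (U\<^sup>* B U)\<^sup>p\<close>, and Loewner--Heinz in both directions
  extracts the \<open>p\<close>-th root.

  The Loewner--Heinz inequality itself is reduced to coercive \<open>B\<close>. There the least \<open>\<alpha>\<^sub>k \<ge> 1\<close> with
  \<open>A\<^sup>k \<le> \<alpha>\<^sub>k B\<^sup>k\<close> form a log-convex sequence, so \<open>\<alpha>\<^sub>0 = \<alpha>\<^sub>N = 1\<close> bounds all of them. Log-convexity
  comes from the Krein--Lax symmetrization argument applied to \<open>B\<^sup>-\<^sup>k A\<^sup>k\<close>.
\<close>

section \<open>Positive forms\<close>

text \<open>The order between self-adjoint operators sees only real diagonal values, so all
  comparisons run through this real bilinear form.\<close>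

definition rinner :: "'a::complex_hilbert_space \<Rightarrow> 'a \<Rightarrow> real" where
  "rinner x y = Re (cinner x y)"

lemma rinner_commute: "rinner x y = rinner y x"
  unfolding rinner_def by (metis cinner_commute complex_cnj(1) cnj.simps(1))

lemma rinner_add_left: "rinner (x + y) z = rinner x z + rinner y z"
  by (simp add: rinner_def cinner_add_left)

lemma rinner_add_right: "rinner x (y + z) = rinner x y + rinner x z"
  by (simp add: rinner_def cinner_add_right)

lemma rinner_scaleR_left: "rinner (r *\<^sub>R x) y = r * rinner x y"
  by (simp add: rinner_def cinner_scaleR_left)

lemma rinner_scaleR_right: "rinner x (r *\<^sub>R y) = r * rinner x y"
  by (simp add: rinner_def cinner_scaleR_right)

lemma rinner_diff_left: "rinner (x - y) z = rinner x z - rinner y z"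
  by (simp add: rinner_def cinner_diff_left)

lemma rinner_diff_right: "rinner x (y - z) = rinner x y - rinner x z"
  by (simp add: rinner_def cinner_diff_right)

lemma rinner_self: "rinner x x = (norm x)\<^sup>2"
  by (simp add: rinner_def cinner_self)

lemma norm_diff_square: "(norm (x - y))\<^sup>2 = (norm x)\<^sup>2 - 2 * rinner x y + (norm y)\<^sup>2"
  using norm_add_square[of x "- y"] by (simp add: rinner_def cinner_minus_right)

lemma abs_rinner_le: "\<bar>rinner x y\<bar> \<le> norm x * norm y"
  unfolding rinner_def by (rule cinner_cauchy_schwarz_Re)

lemma bounded_bilinear_rinner: "bounded_bilinear rinner"
  by standard (auto simp: rinner_add_left rinner_add_right rinner_scaleR_left
      rinner_scaleR_right intro!: exI[of _ 1] abs_rinner_le)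

lemmas tendsto_rinner = bounded_bilinear.tendsto[OF bounded_bilinear_rinner]

lemma rinner_eqI:
  assumes "\<And>x. rinner x y = rinner x z"
  shows "y = z"
  using assms[of "y - z"] rinner_self[of "y - z"] by (simp add: rinner_diff_right)

text \<open>Bare real-linear functions instead of bounded operators, so that powers are iterates
  \<open>A ^^ k\<close> and perturbed maps need no repackaging.\<close>

definition pos_map :: "('a::complex_hilbert_space \<Rightarrow> 'a) \<Rightarrow> bool" where
  "pos_map A \<longleftrightarrow> bounded_linear A \<and> (\<forall>x y. rinner (A x) y = rinner x (A y))
     \<and> (\<forall>x. 0 \<le> rinner (A x) x)"

lemma pos_mapD:
  assumes "pos_map A"
  shows "bounded_linear A" "rinner (A x) y = rinner x (A y)" "0 \<le> rinner (A x) x"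
  using assms by (auto simp: pos_map_def)

lemma pos_map_shift:
  assumes A: "pos_map A" and e: "0 \<le> e"
  shows "pos_map (\<lambda>x. A x + e *\<^sub>R x)"
  using pos_mapD[OF A] e unfolding pos_map_def
  by (auto intro!: bounded_linear_add bounded_linear_scaleR_right add_nonneg_nonneg
      simp: rinner_add_left rinner_add_right rinner_scaleR_left rinner_scaleR_right rinner_self)

lemma funpow_symmetric:
  assumes "\<And>x y. rinner (A x) y = rinner x (A y)"
  shows "rinner ((A ^^ k) x) y = rinner x ((A ^^ k) y)"
proof (induction k arbitrary: x)
  case (Suc k)
  then show ?case by (simp add: assms funpow_swap1)
qed simp

lemma pos_map_funpow:
  assumes A: "pos_map A"
  shows "pos_map (A ^^ k)"
proof -
  note sym = funpow_symmetric[of A, OF pos_mapD(2)[OF A]]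
  have "bounded_linear (A ^^ k)"
  proof (induction k)
    case (Suc k)
    then show ?case
      using bounded_linear_compose[OF pos_mapD(1)[OF A]] by (simp add: o_def)
  qed (simp add: id_def)
  moreover have "0 \<le> rinner ((A ^^ k) x) x" for x
  proof -
    \<comment> \<open>Even powers give the squared norm of \<open>(A ^^ i) x\<close>, odd ones the
      form of \<open>A\<close> at that vector.\<close>
    consider i where "k = i + i" | i where "k = i + Suc i"
      by (metis add_Suc_right evenE mult_2 oddE Suc_eq_plus1)
    then show ?thesis
    proof cases
      case 1
      then show ?thesis by (simp only: funpow_add o_apply sym rinner_self) simp
    next
      case 2
      then have "(A ^^ k) x = (A ^^ i) (A ((A ^^ i) x))"
        by (simp only: funpow_add funpow.simps o_apply)
      then have "rinner ((A ^^ k) x) x = rinner (A ((A ^^ i) x)) ((A ^^ i) x)"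
        by (simp add: sym[of i "A ((A ^^ i) x)"])
      then show ?thesis using pos_mapD(3)[OF A] by simp
    qed
  qed
  ultimately show ?thesis
    using sym by (auto simp: pos_map_def)
qed

text \<open>Discriminant argument for a form that may be degenerate, hence the separate case
  \<open>?c = 0\<close>.\<close>

lemma pos_map_cauchy_schwarz:
  assumes A: "pos_map A"
  shows "(rinner (A x) y)\<^sup>2 \<le> rinner (A x) x * rinner (A y) y"
proof -
  interpret bounded_linear A by (rule pos_mapD(1)[OF A])
  let ?a = "rinner (A x) x" and ?b = "rinner (A x) y" and ?c = "rinner (A y) y"
  have b: "rinner (A y) x = ?b"
    using pos_mapD(2)[OF A, of y x] by (simp add: rinner_commute)
  have *: "0 \<le> s\<^sup>2 * ?a + 2 * s * t * ?b + t\<^sup>2 * ?c" for s t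
    using pos_mapD(3)[OF A, of "s *\<^sub>R x + t *\<^sub>R y"]
    by (simp add: add scaleR rinner_add_left rinner_add_right rinner_scaleR_left
        rinner_scaleR_right b power2_eq_square algebra_simps)
  have nn: "0 \<le> ?a" "0 \<le> ?c"
    using pos_mapD(3)[OF A] by auto
  show ?thesis
  proof (cases "?c = 0")
    case False
    have "0 \<le> ?c * (?a * ?c - ?b\<^sup>2)"
      using *[of ?c "- ?b"] by (simp add: power2_eq_square algebra_simps)
    then show ?thesis
      using nn False by (simp add: zero_le_mult_iff)
  next
    case True
    have "?b = 0"
    proof (rule ccontr)
      assume "?b \<noteq> 0"
      \<comment> \<open>With \<open>?c = 0\<close> the form is affine in \<open>t\<close>; this
        \<open>t\<close> gives it the value \<open>- ?a - 2\<close>.\<close>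
      moreover have "0 \<le> ?a + 2 * (- (?a + 1) / ?b) * ?b"
        using *[of 1 "- (?a + 1) / ?b"] True by simp
      ultimately show False using nn by simp
    qed
    then show ?thesis using nn by simp
  qed
qed

section \<open>The Loewner--Heinz inequality for integer powers\<close>

text \<open>Log-convexity makes the ratios of consecutive terms nondecreasing, so an initial ratio
  \<open>r > d\<close> would force growth like \<open>r ^ j\<close>, against the bound
  \<open>K * d ^ j\<close>.\<close>

lemma log_convex_seq_step:
  fixes u :: "nat \<Rightarrow> real"
  assumes nn: "\<And>j. 0 \<le> u j" and conv: "\<And>j. (u (Suc j))\<^sup>2 \<le> u j * u (Suc (Suc j))"
    and bound: "\<And>j. u j \<le> K * d ^ j" and d: "0 < d"
  shows "u 1 \<le> d * u 0"
proof (rule ccontr)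
  assume "\<not> u 1 \<le> d * u 0"
  then have less: "d * u 0 < u 1" by simp
  have u0: "0 < u 0"
    using conv[of 0] less nn[of 0] by (cases "u 0 = 0") auto
  define r where "r = u 1 / u 0"
  have r: "d < r"
    using less u0 by (simp add: r_def field_simps)
  have step: "0 < u j \<and> r * u j \<le> u (Suc j)" for j
  proof (induction j)
    case 0
    then show ?case using u0 by (simp add: r_def)
  next
    case (Suc j)
    have pos: "0 < u (Suc j)"
      using Suc d r by (meson less_le_trans less_trans mult_pos_pos)
    have "u (Suc j) * (r * u (Suc j)) = r * (u (Suc j))\<^sup>2"
      by (simp add: power2_eq_square)
    also have "\<dots> \<le> r * (u j * u (Suc (Suc j)))"
      using conv[of j] d r by (intro mult_left_mono) auto
    also have "\<dots> = (r * u j) * u (Suc (Suc j))"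
      by simp
    also have "\<dots> \<le> u (Suc j) * u (Suc (Suc j))"
      using Suc nn by (intro mult_right_mono) auto
    finally show ?case using pos by simp
  qed
  have "r ^ j * u 0 \<le> u j" for j
  proof (induction j)
    case (Suc j)
    have "r * (r ^ j * u 0) \<le> r * u j"
      using Suc d r by (intro mult_left_mono) auto
    then show ?case using step[of j] by (simp add: mult.assoc)
  qed simp
  then have "r ^ j * u 0 \<le> K * d ^ j" for j
    using bound order_trans by blast
  then have "(r / d) ^ j \<le> K / u 0" for j
    using u0 d by (simp add: power_divide field_simps)
  moreover have "1 < r / d"
    using r d by simp
  ultimately show False
    using real_arch_pow[of "r / d" "K / u 0"] by (meson not_less)
qed

text \<open>The sequence \<open>\<parallel>M\<^sup>j x\<parallel>\<^sub>R\<^sup>2\<close> is log-convex and, through \<open>P\<close>, grows at most like \<open>c\<^sup>2\<^sup>j\<close>.\<close>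

lemma symmetrizable_bound:
  assumes P: "pos_map P" and R: "pos_map R"
    and sym: "\<And>x y. rinner (R (M x)) y = rinner (R x) (M y)"
    and bound: "\<And>x. rinner (P (M x)) (M x) \<le> c\<^sup>2 * rinner (P x) x"
    and dom: "\<And>x. rinner (R x) x \<le> C * rinner (P x) x"
    and c: "0 < c" and C: "0 \<le> C"
  shows "rinner (R (M x)) x \<le> c * rinner (R x) x"
proof -
  define u where "u j = rinner (R ((M ^^ j) x)) ((M ^^ j) x)" for j
  have u_nn: "0 \<le> u j" for j
    using pos_mapD(3)[OF R] by (simp add: u_def)
  have "u 1 \<le> c\<^sup>2 * u 0"
  proof (rule log_convex_seq_step)
    show "(u (Suc j))\<^sup>2 \<le> u j * u (Suc (Suc j))" for j
    proof -
      \<comment> \<open>One \<open>M\<close> moves across the form of \<open>R\<close>, so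
        Cauchy-Schwarz brings in the terms \<open>j\<close> and \<open>j + 2\<close>.\<close>
      have "u (Suc j) = rinner (R ((M ^^ j) x)) ((M ^^ Suc (Suc j)) x)"
        by (simp add: u_def sym)
      then show ?thesis
        using pos_map_cauchy_schwarz[OF R] by (simp add: u_def)
    qed
    have P_bound: "rinner (P ((M ^^ j) x)) ((M ^^ j) x) \<le> (c\<^sup>2) ^ j * rinner (P x) x" for j
    proof (induction j)
      case (Suc j)
      have "rinner (P ((M ^^ Suc j) x)) ((M ^^ Suc j) x)
          \<le> c\<^sup>2 * rinner (P ((M ^^ j) x)) ((M ^^ j) x)"
        using bound by simp
      also have "\<dots> \<le> c\<^sup>2 * ((c\<^sup>2) ^ j * rinner (P x) x)"
        using Suc by (intro mult_left_mono) auto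
      finally show ?case by (simp add: mult.assoc)
    qed simp
    show "u j \<le> C * rinner (P x) x * (c\<^sup>2) ^ j" for j
    proof -
      have "u j \<le> C * rinner (P ((M ^^ j) x)) ((M ^^ j) x)"
        using dom by (simp add: u_def)
      also have "\<dots> \<le> C * ((c\<^sup>2) ^ j * rinner (P x) x)"
        using P_bound C by (rule mult_left_mono)
      finally show ?thesis by (simp add: ac_simps)
    qed
  qed (use c u_nn in auto)
  moreover have "(rinner (R (M x)) x)\<^sup>2 \<le> u 1 * u 0"
    using pos_map_cauchy_schwarz[OF R, of "M x" x] by (simp add: u_def)
  ultimately have "(rinner (R (M x)) x)\<^sup>2 \<le> (c\<^sup>2 * u 0) * u 0"
    using mult_right_mono[OF _ u_nn[of 0]] order_trans by blast
  then have "(rinner (R (M x)) x)\<^sup>2 \<le> (c * u 0)\<^sup>2"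
    by (simp add: power2_eq_square ac_simps)
  then have "rinner (R (M x)) x \<le> c * u 0"
    by (rule power2_le_imp_le) (use c u_nn[of 0] in auto)
  then show ?thesis by (simp add: u_def)
qed

text \<open>Symmetrization with the forms of \<open>P = B\<^sup>k\<close> and \<open>R = B\<^sup>m\<close> and with \<open>M = B\<^sup>-\<^sup>m A\<^sup>m\<close>, where
  \<open>m = k + 1\<close>.\<close>

lemma power_interpolation:
  assumes A: "pos_map A" and B: "pos_map B" and surj: "surj B"
    and low: "\<And>x. rinner ((A ^^ k) x) x \<le> a\<^sup>2 * rinner ((B ^^ k) x) x"
    and high: "\<And>x. rinner ((A ^^ Suc (Suc k)) x) x \<le> b\<^sup>2 * rinner ((B ^^ Suc (Suc k)) x) x"
    and dom: "\<And>x. rinner ((B ^^ Suc k) x) x \<le> C * rinner ((B ^^ k) x) x"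
    and pos: "0 < a" "0 < b" "0 \<le> C"
  shows "rinner ((A ^^ Suc k) x) x \<le> a * b * rinner ((B ^^ Suc k) x) x"
proof -
  \<comment> \<open>\<open>inv\<close> merely selects a preimage; what follows uses only the
    equation it satisfies.\<close>
  define M where "M x = inv (B ^^ Suc k) ((A ^^ Suc k) x)" for x
  have M: "(B ^^ Suc k) (M x) = (A ^^ Suc k) x" for x
    unfolding M_def by (rule surj_f_inv_f[OF surj_fn[OF surj]])
  note Asym = pos_mapD(2)[OF pos_map_funpow[OF A]]
    and Bsym = pos_mapD(2)[OF pos_map_funpow[OF B]]
  have "rinner ((B ^^ Suc k) (M x)) x \<le> a * b * rinner ((B ^^ Suc k) x) x"
  proof (rule symmetrizable_bound[of "B ^^ k"])
    show "rinner ((B ^^ Suc k) (M x)) y = rinner ((B ^^ Suc k) x) (M y)" for x y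
      by (simp only: M Bsym[of "Suc k" x "M y"] Asym)
    show "rinner ((B ^^ k) (M x)) (M x) \<le> (a * b)\<^sup>2 * rinner ((B ^^ k) x) x" for x
    proof -
      define s where "s = rinner ((B ^^ k) (M x)) (M x)"
      define t where "t = rinner ((B ^^ k) x) x"
      have s: "0 \<le> s" and t: "0 \<le> t"
        using pos_mapD(3)[OF pos_map_funpow[OF B]] by (auto simp: s_def t_def)
      \<comment> \<open>Writing \<open>M x = B y\<close> turns \<open>s\<close> into the mixed term
        of the form of \<open>A ^^ k\<close> at \<open>x\<close> and \<open>A y\<close>. After
        Cauchy-Schwarz, \<open>low\<close> applies at \<open>x\<close> and \<open>high\<close> at
        \<open>y\<close>; the latter returns a factor \<open>s\<close>, which cancels.\<close>
      obtain y where y: "M x = B y"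
        using surj by (metis surjD)
      have "s = rinner ((B ^^ Suc k) (M x)) y"
        unfolding s_def by (subst (2) y) (simp add: pos_mapD(2)[OF B])
      also have "\<dots> = rinner ((A ^^ k) x) (A y)"
        by (simp add: M pos_mapD(2)[OF A] del: funpow.simps) (simp add: pos_mapD(2)[OF A])
      finally have "s\<^sup>2 \<le> rinner ((A ^^ k) x) x * rinner ((A ^^ k) (A y)) (A y)"
        using pos_map_cauchy_schwarz[OF pos_map_funpow[OF A]] by simp
      also have "rinner ((A ^^ k) (A y)) (A y) = rinner ((A ^^ Suc (Suc k)) y) y"
        by (simp add: pos_mapD(2)[OF A, symmetric] funpow_swap1)
      also have "rinner ((A ^^ k) x) x * \<dots>
          \<le> (a\<^sup>2 * t) * (b\<^sup>2 * rinner ((B ^^ Suc (Suc k)) y) y)"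
        unfolding t_def
        using pos_mapD(3)[OF pos_map_funpow[OF A], of "Suc (Suc k)" y]
          pos_mapD(3)[OF pos_map_funpow[OF B], of k x]
        by (intro mult_mono low high) auto
      also have "rinner ((B ^^ Suc (Suc k)) y) y = s"
        by (simp add: s_def y pos_mapD(2)[OF B, symmetric] funpow_swap1)
      finally have "s * s \<le> s * ((a * b)\<^sup>2 * t)"
        by (simp add: power2_eq_square ac_simps)
      then have "s \<le> (a * b)\<^sup>2 * t"
        using s t by (cases "s = 0") (auto simp: mult_le_cancel_left)
      then show ?thesis by (simp add: s_def t_def)
    qed
  qed (use pos dom pos_map_funpow[OF B] in \<open>auto simp del: funpow.simps\<close>)
  then show ?thesis by (simp only: M)
qed

text \<open>The relaxation \<open>x - t *\<^sub>R (B x - y)\<close> is a contraction for a suitable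
  \<open>t\<close>, and its Banach fixed point solves \<open>B x = y\<close>.\<close>

lemma coercive_imp_surj:
  assumes B: "pos_map B" and d: "0 < d" and coercive: "\<And>x. d * (norm x)\<^sup>2 \<le> rinner (B x) x"
  shows "surj B"
proof -
  interpret bounded_linear B by (rule pos_mapD(1)[OF B])
  obtain K where K: "0 < K" "\<And>x. norm (B x) \<le> norm x * K"
    using pos_bounded by blast
  define L where "L = K + d"
  have L: "0 < L" "d \<le> L" using K d by (auto simp: L_def)
  have BL: "norm (B x) \<le> L * norm x" for x
    using K(2)[of x] d by (simp add: L_def algebra_simps add_increasing2)
  \<comment> \<open>This \<open>t\<close> minimises
    \<open>1 - 2 * t * d + t\<^sup>2 * L\<^sup>2\<close>, with minimum \<open>c\<^sup>2\<close>; the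
    summand \<open>d\<close> in \<open>L\<close> keeps that nonnegative.\<close>
  define t where "t = d / L\<^sup>2"
  define c where "c = sqrt (1 - d\<^sup>2 / L\<^sup>2)"
  have t: "0 < t" using d L by (simp add: t_def)
  have dL: "d\<^sup>2 / L\<^sup>2 \<le> 1" "0 < d\<^sup>2 / L\<^sup>2"
    using d L by (auto simp: power_mono)
  have c: "0 \<le> c" "c < 1"
    using dL by (auto simp: c_def real_sqrt_lt_1_iff)
  have contr: "norm (x - t *\<^sub>R B x) \<le> c * norm x" for x
  proof -
    have "(norm (x - t *\<^sub>R B x))\<^sup>2 = (norm x)\<^sup>2 - 2 * t * rinner (B x) x + t\<^sup>2 * (norm (B x))\<^sup>2"
      by (simp add: norm_diff_square rinner_scaleR_right rinner_commute[of x] power_mult_distrib)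
    also have "\<dots> \<le> (1 - d\<^sup>2 / L\<^sup>2) * (norm x)\<^sup>2"
    proof -
      have "t * (d * (norm x)\<^sup>2) \<le> t * rinner (B x) x"
        using t by (intro mult_left_mono coercive) auto
      moreover have "t * (d * (norm x)\<^sup>2) = d\<^sup>2 / L\<^sup>2 * (norm x)\<^sup>2"
        by (simp add: t_def power2_eq_square)
      moreover have "t\<^sup>2 * (norm (B x))\<^sup>2 \<le> t\<^sup>2 * (L * norm x)\<^sup>2"
        using BL by (intro mult_left_mono power_mono) auto
      moreover have "t\<^sup>2 * (L * norm x)\<^sup>2 = d\<^sup>2 / L\<^sup>2 * (norm x)\<^sup>2"
      proof -
        have "t * (L * norm x) = d / L * norm x"
          using L(1) by (simp add: t_def power2_eq_square)
        then show ?thesis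
          by (metis power_divide power_mult_distrib)
      qed
      ultimately show ?thesis
        by (simp add: left_diff_distrib)
    qed
    also have "\<dots> = (c * norm x)\<^sup>2"
      using dL by (simp add: c_def power_mult_distrib)
    finally show ?thesis
      by (rule power2_le_imp_le) (use c in auto)
  qed
  have fixpoint: "\<exists>!x. x - t *\<^sub>R (B x - y) = x" for y
  proof (rule banach_fix_type[OF c], intro allI)
    fix x z
    have "x - t *\<^sub>R (B x - y) - (z - t *\<^sub>R (B z - y)) = (x - z) - t *\<^sub>R B (x - z)"
      by (simp add: diff scaleR_diff_right)
    then show "dist (x - t *\<^sub>R (B x - y)) (z - t *\<^sub>R (B z - y)) \<le> c * dist x z"
      using contr[of "x - z"] by (simp only: dist_norm)
  qed
  have "\<exists>x. y = B x" for y
  proof -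
    obtain x where x: "x - t *\<^sub>R (B x - y) = x"
      using fixpoint[of y] by blast
    have "t *\<^sub>R (B x - y) = x - (x - t *\<^sub>R (B x - y))"
      by (simp only: diff_diff_eq2 add_diff_cancel_left')
    also have "\<dots> = 0"
      by (simp only: x diff_self)
    finally show ?thesis
      using t by auto
  qed
  then show ?thesis
    unfolding surj_def by blast
qed

text \<open>Discrete maximum principle: log-convexity excludes an interior maximum above the end
  values.\<close>

lemma log_convex_le_one:
  fixes \<alpha> :: "nat \<Rightarrow> real"
  assumes ge: "\<And>k. 1 \<le> \<alpha> k" and ends: "\<alpha> 0 = 1" "\<alpha> N = 1"
    and conv: "\<And>k. Suc k < N \<Longrightarrow> (\<alpha> (Suc k))\<^sup>2 \<le> \<alpha> k * \<alpha> (Suc (Suc k))"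
    and k: "k \<le> N"
  shows "\<alpha> k = 1"
proof -
  define m where "m = Max (\<alpha> ` {..N})"
  have le: "\<alpha> i \<le> m" if "i \<le> N" for i
    using that by (auto simp: m_def)
  have "m \<in> \<alpha> ` {..N}"
    unfolding m_def by (rule Max_in) auto
  then obtain i where i: "i \<le> N" "\<alpha> i = m" by auto
  \<comment> \<open>At the first index of the maximum the left neighbour is strictly smaller, which
    makes the final estimate strict.\<close>
  define j where "j = (LEAST j. \<alpha> j = m)"
  have j: "\<alpha> j = m" "j \<le> i"
    unfolding j_def using i(2) by (auto intro: LeastI Least_le)
  have before: "\<alpha> l \<noteq> m" if "l < j" for l
    using that not_less_Least unfolding j_def by blast
  have "m = 1"
  proof (rule ccontr)
    assume "m \<noteq> 1"
    then have "j \<noteq> 0" "j \<noteq> N" using j(1) ends by metis+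
    then obtain l where l: "j = Suc l" "Suc l < N"
      using j i by (metis le_neq_implies_less not0_implies_Suc order_trans)
    have "m * m \<le> \<alpha> l * \<alpha> (Suc (Suc l))"
      using conv[OF l(2)] j(1) l(1) by (simp add: power2_eq_square)
    also have "\<dots> \<le> \<alpha> l * m"
      using le[of "Suc (Suc l)"] l ge[of l] by (intro mult_left_mono) auto
    also have "\<dots> < m * m"
      using before[of l] le[of l] l ge[of j] j(1) by (intro mult_strict_right_mono) auto
    finally show False by simp
  qed
  then show ?thesis using le[OF k] ge[of k] by simp
qed

text \<open>Coercivity lets each \<open>B ^^ k\<close> dominate every bounded form, so finite
  constants exist; for \<open>k = 1\<close> it also makes \<open>B\<close> onto, as the
  symmetrization requires.\<close>

lemma power_mono_coercive:
  assumes A: "pos_map A" and B: "pos_map B"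
    and coercive: "\<And>k. \<exists>d>0. \<forall>x. d * (norm x)\<^sup>2 \<le> rinner ((B ^^ k) x) x"
    and le: "\<And>x. rinner ((A ^^ N) x) x \<le> rinner ((B ^^ N) x) x"
    and k: "k \<le> N"
  shows "rinner ((A ^^ k) x) x \<le> rinner ((B ^^ k) x) x"
proof -
  note B_nn = pos_mapD(3)[OF pos_map_funpow[OF B]]
  have dom: "\<exists>C\<ge>0. \<forall>x. rinner (T x) x \<le> C * rinner ((B ^^ k) x) x" if T: "bounded_linear T" for T k
  proof -
    obtain K where K: "0 < K" "\<And>x. norm (T x) \<le> norm x * K"
      using bounded_linear.pos_bounded[OF T] by blast
    obtain d where d: "0 < d" "\<And>x. d * (norm x)\<^sup>2 \<le> rinner ((B ^^ k) x) x"
      using coercive by blast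
    have "rinner (T x) x \<le> K / d * rinner ((B ^^ k) x) x" for x
    proof -
      have "rinner (T x) x \<le> norm (T x) * norm x"
        using abs_rinner_le[of "T x" x] by simp
      also have "\<dots> \<le> (norm x * K) * norm x"
        by (intro mult_right_mono K) auto
      also have "\<dots> = K / d * (d * (norm x)\<^sup>2)"
        using d(1) by (simp add: power2_eq_square)
      also have "\<dots> \<le> K / d * rinner ((B ^^ k) x) x"
        using K(1) d by (intro mult_left_mono) auto
      finally show ?thesis .
    qed
    then show ?thesis
      using K(1) d(1) by (intro exI[of _ "K / d"]) auto
  qed
  \<comment> \<open>The floor \<open>1 \<le> c\<close> keeps the optimal constants positive and
    makes them exactly 1 at the exponents 0 and \<open>N\<close>.\<close>
  define S where "S k = {c. 1 \<le> c \<and> (\<forall>x. rinner ((A ^^ k) x) x \<le> c * rinner ((B ^^ k) x) x)}" for k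
  define \<alpha> where "\<alpha> k = Inf (S k)" for k
  have bdd: "bdd_below (S k)" for k
    by (auto simp: S_def intro: bdd_belowI)
  have S_ne: "S k \<noteq> {}" for k
  proof -
    obtain C where C: "0 \<le> C" "\<And>x. rinner ((A ^^ k) x) x \<le> C * rinner ((B ^^ k) x) x"
      using dom[OF pos_mapD(1)[OF pos_map_funpow[OF A]]] by blast
    have "C + 1 \<in> S k"
      using C(1) order_trans[OF C(2) mult_right_mono[OF _ B_nn, of C "C + 1"]]
      by (auto simp: S_def)
    then show ?thesis by blast
  qed
  have "closed (S k)" for k
    unfolding S_def by (intro closed_Collect_conj closed_Collect_all closed_Collect_le continuous_intros)
  then have in_S: "\<alpha> k \<in> S k" for k
    unfolding \<alpha>_def by (intro closed_contains_Inf S_ne bdd)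
  have one: "1 \<in> S k \<Longrightarrow> \<alpha> k = 1" for k
    using in_S[of k] cInf_lower[OF _ bdd, of 1 k] by (auto simp: \<alpha>_def S_def)
  obtain d where "0 < d" "\<And>x. d * (norm x)\<^sup>2 \<le> rinner (B x) x"
    using coercive[of 1] by auto
  then have surj: "surj B"
    using coercive_imp_surj[OF B] by blast
  have "\<alpha> k = 1"
  proof (rule log_convex_le_one[OF _ _ _ _ k])
    show ge: "1 \<le> \<alpha> k" for k
      using in_S by (simp add: S_def)
    show "\<alpha> 0 = 1" "\<alpha> N = 1"
      using le by (auto intro!: one simp: S_def)
    show "(\<alpha> (Suc k))\<^sup>2 \<le> \<alpha> k * \<alpha> (Suc (Suc k))" for k
    proof -
      obtain C where C: "0 \<le> C" "\<And>x. rinner ((B ^^ Suc k) x) x \<le> C * rinner ((B ^^ k) x) x"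
        using dom[OF pos_mapD(1)[OF pos_map_funpow[OF B]]] by blast
      have pos: "0 < \<alpha> k" for k using ge[of k] by linarith
      \<comment> \<open>Square roots appear because \<open>power_interpolation\<close> takes the
        squares of its constants as bounds.\<close>
      have "rinner ((A ^^ Suc k) x) x \<le> sqrt (\<alpha> k) * sqrt (\<alpha> (Suc (Suc k))) * rinner ((B ^^ Suc k) x) x" for x
        using in_S[of k] in_S[of "Suc (Suc k)"] pos[of k] pos[of "Suc (Suc k)"]
        by (intro power_interpolation[OF A B surj _ _ C(2)] C(1))
          (auto simp: S_def simp del: funpow.simps)
      moreover have "1 * 1 \<le> sqrt (\<alpha> k) * sqrt (\<alpha> (Suc (Suc k)))"
        using ge order_trans[OF zero_le_one ge] by (intro mult_mono) auto
      ultimately have "sqrt (\<alpha> k) * sqrt (\<alpha> (Suc (Suc k))) \<in> S (Suc k)"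
        by (auto simp: S_def simp del: funpow.simps)
      then have "\<alpha> (Suc k) \<le> sqrt (\<alpha> k * \<alpha> (Suc (Suc k)))"
        unfolding \<alpha>_def[of "Suc k"] using bdd by (auto simp: real_sqrt_mult intro: cInf_lower)
      then have "(\<alpha> (Suc k))\<^sup>2 \<le> (sqrt (\<alpha> k * \<alpha> (Suc (Suc k))))\<^sup>2"
        using ge[of "Suc k"] by (intro power_mono) auto
      then show ?thesis
        using pos[of k] pos[of "Suc (Suc k)"] by simp
    qed
  qed
  then show ?thesis
    using in_S[of k] by (auto simp: S_def)
qed

section \<open>From coercive to general positive maps: the shifts of \<open>B\<close> by
  \<open>e\<close>\<close>

lemma funpow_shift_step:
  fixes e :: real
  assumes B: "pos_map B"
  defines "F \<equiv> \<lambda>x. B x + e *\<^sub>R x"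
  shows "rinner ((B ^^ j) ((F ^^ Suc n) x)) x
      = rinner ((B ^^ Suc j) ((F ^^ n) x)) x + e * rinner ((B ^^ j) ((F ^^ n) x)) x"
proof -
  interpret bounded_linear "B ^^ j"
    by (rule pos_mapD(1)[OF pos_map_funpow[OF B]])
  have "(F ^^ Suc n) x = B ((F ^^ n) x) + e *\<^sub>R (F ^^ n) x"
    by (simp add: F_def)
  moreover have "(B ^^ Suc j) z = (B ^^ j) (B z)" for z
    by (simp add: funpow_swap1)
  ultimately show ?thesis
    by (simp only: add scaleR rinner_add_left rinner_scaleR_left)
qed

text \<open>The leading power \<open>B ^^ j\<close> is kept general because each induction step
  moves one factor \<open>B\<close> there; the terms carrying \<open>e\<close> are nonnegative and
  dropped.\<close>

lemma funpow_shift_ge_funpow: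
  assumes B: "pos_map B" and e: "0 \<le> e"
  shows "rinner ((B ^^ (j + n)) x) x \<le> rinner ((B ^^ j) (((\<lambda>x. B x + e *\<^sub>R x) ^^ n) x)) x"
    (is "_ \<le> ?g j n")
proof (induction n arbitrary: j)
  case (Suc n)
  have "0 \<le> e * ?g j n"
    using order_trans[OF pos_mapD(3)[OF pos_map_funpow[OF B]] Suc[of j]] by (rule mult_nonneg_nonneg[OF e])
  moreover have "?g j (Suc n) = ?g (Suc j) n + e * ?g j n"
    by (rule funpow_shift_step[OF B])
  moreover have "rinner ((B ^^ (j + Suc n)) x) x \<le> ?g (Suc j) n"
    using Suc[of "Suc j"] by (simp only: add_Suc_shift)
  ultimately show ?case by linarith
qed simp

text \<open>Here the terms carrying \<open>e\<close> are the ones kept. For \<open>j = 0\<close>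
  this is coercivity of the powers of the shift, with constant \<open>e ^ n\<close>.\<close>

lemma funpow_shift_ge_power:
  assumes B: "pos_map B" and e: "0 \<le> e"
  shows "e ^ n * rinner ((B ^^ j) x) x \<le> rinner ((B ^^ j) (((\<lambda>x. B x + e *\<^sub>R x) ^^ n) x)) x"
    (is "_ \<le> ?g j n")
proof (induction n)
  case (Suc n)
  have "0 \<le> ?g (Suc j) n"
    using order_trans[OF pos_mapD(3)[OF pos_map_funpow[OF B]] funpow_shift_ge_funpow[OF B e]] .
  moreover have "e * (e ^ n * rinner ((B ^^ j) x) x) \<le> e * ?g j n"
    using Suc e by (rule mult_left_mono)
  moreover have "?g j (Suc n) = ?g (Suc j) n + e * ?g j n"
    by (rule funpow_shift_step[OF B])
  ultimately show ?case
    by (simp only: power_Suc mult.assoc)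
qed simp

text \<open>The Loewner--Heinz inequality for the exponents \<open>k / N\<close>.\<close>

lemma power_le_imp_power_le:
  assumes A: "pos_map A" and B: "pos_map B"
    and le: "\<And>x. rinner ((A ^^ N) x) x \<le> rinner ((B ^^ N) x) x"
    and k: "k \<le> N"
  shows "rinner ((A ^^ k) x) x \<le> rinner ((B ^^ k) x) x"
proof -
  define F where "F e = (\<lambda>x. B x + e *\<^sub>R x)" for e :: real
  have "rinner ((A ^^ k) x) x \<le> rinner ((F e ^^ k) x) x" if e: "0 < e" for e
  proof (rule power_mono_coercive[OF A _ _ _ k])
    show "pos_map (F e)"
      unfolding F_def using B e by (intro pos_map_shift) auto
    show "\<exists>d>0. \<forall>x. d * (norm x)\<^sup>2 \<le> rinner ((F e ^^ k) x) x" for k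
      using funpow_shift_ge_power[OF B less_imp_le[OF e], where j = 0] e
      by (intro exI[of _ "e ^ k"]) (auto simp: F_def rinner_self)
    show "rinner ((A ^^ N) x) x \<le> rinner ((F e ^^ N) x) x" for x
      using order_trans[OF le[of x] funpow_shift_ge_funpow[OF B less_imp_le[OF e], where j = 0, simplified]]
      by (simp add: F_def)
  qed
  \<comment> \<open>Powers of the shift depend continuously on \<open>e\<close> and
    \<open>F 0\<close> is \<open>B\<close>, so the inequality survives the limit from the
    right.\<close>
  moreover have "((\<lambda>e. (F e ^^ k) x) \<longlongrightarrow> (F 0 ^^ k) x) (at_right 0)"
  proof (induction k)
    case (Suc k)
    have "((\<lambda>e. B ((F e ^^ k) x) + e *\<^sub>R (F e ^^ k) x)
        \<longlongrightarrow> B ((F 0 ^^ k) x) + 0 *\<^sub>R (F 0 ^^ k) x) (at_right 0)"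
      by (intro tendsto_add tendsto_scaleR tendsto_ident_at Suc
          bounded_linear.tendsto[OF pos_mapD(1)[OF B]])
    moreover have "(F e ^^ Suc k) x = B ((F e ^^ k) x) + e *\<^sub>R (F e ^^ k) x" for e
      by (simp add: F_def)
    ultimately show ?case by (simp only:)
  qed simp
  then have "((\<lambda>e. rinner ((F e ^^ k) x) x) \<longlongrightarrow> rinner ((F 0 ^^ k) x) x) (at_right 0)"
    by (intro tendsto_rinner tendsto_const)
  ultimately have "rinner ((A ^^ k) x) x \<le> rinner ((F 0 ^^ k) x) x"
    by (intro tendsto_lowerbound[where F = "at_right 0"])
      (auto simp: eventually_at_right_less intro: eventually_mono[OF eventually_at_right_less])
  then show ?thesis by (simp add: F_def)
qed

section \<open>Bounded operators and unitaries\<close>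

lemma cinner_eqI_left:
  assumes "\<And>z. cinner x z = cinner y z"
  shows "x = y"
proof (rule cinner_eqI)
  show "cinner z x = cinner z y" for z
    using assms[of z] by (metis cinner_commute)
qed

lemma bounded_operatorsD:
  "T \<in> bounded_operators \<Longrightarrow> T (c *\<^sub>C x) = c *\<^sub>C T x"
  by (simp add: bounded_operators_def)

lemma bounded_operators_compose:
  "S \<in> bounded_operators \<Longrightarrow> T \<in> bounded_operators \<Longrightarrow> S o\<^sub>L T \<in> bounded_operators"
  by (simp add: bounded_operators_def)

lemma adj_eqI:
  fixes S T :: "'a::complex_hilbert_space \<Rightarrow>\<^sub>L 'a"
  assumes "T \<in> bounded_operators" and "\<And>x y. cinner (T x) y = cinner x (S y)"
  shows "adj T = S"
  using adj_spec(2)[OF assms(1)] assms(2) by (intro adjoint_unique[of T]) auto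

lemma selfadjoint_iff:
  "selfadjoint T \<longleftrightarrow> T \<in> bounded_operators \<and> (\<forall>x y. cinner (T x) y = cinner x (T y))"
  unfolding selfadjoint_def using adj_eqI[of T T] adj_spec(2)[of T] by auto

text \<open>Self-adjointness makes the diagonal coefficients of \<open>T - S\<close> real, so only
  their real parts remain to be compared.\<close>

lemma op_le_iff:
  "op_le S T \<longleftrightarrow> selfadjoint S \<and> selfadjoint T \<and> (\<forall>x. rinner (S x) x \<le> rinner (T x) x)"
proof -
  have "cinner ((T - S) x) x \<in> \<real>\<^sub>\<ge>\<^sub>0 \<longleftrightarrow> rinner (S x) x \<le> rinner (T x) x"
    if "selfadjoint S" "selfadjoint T" for x
  proof -
    have "cnj (cinner ((T - S) x) x) = cinner x ((T - S) x)"
      by (rule cinner_commute[symmetric])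
    also have "\<dots> = cinner ((T - S) x) x"
      using that by (simp add: selfadjoint_iff blinfun.diff_left cinner_diff_left cinner_diff_right)
    finally have "Im (cinner ((T - S) x) x) = 0"
      by (simp add: complex_eq_iff)
    then show ?thesis
      by (simp add: complex_nonneg_Reals_iff rinner_def blinfun.diff_left cinner_diff_left)
  qed
  then show ?thesis by (auto simp: op_le_def)
qed

lemma op_power_apply: "op_power T n x = (blinfun_apply T ^^ n) x"
  by (induction n) (simp_all add: op_power_def)

lemma selfadjoint_op_power:
  assumes "selfadjoint T"
  shows "selfadjoint (op_power T n)"
proof -
  have T: "T (c *\<^sub>C x) = c *\<^sub>C T x" "cinner (T x) y = cinner x (T y)" for c x y
    using assms by (auto simp: selfadjoint_iff bounded_operators_def)
  have "(blinfun_apply T ^^ n) (c *\<^sub>C x) = c *\<^sub>C (blinfun_apply T ^^ n) x" for c x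
    by (induction n) (simp_all add: T(1))
  moreover have "cinner ((blinfun_apply T ^^ n) x) y = cinner x ((blinfun_apply T ^^ n) y)" for x y
    by (induction n arbitrary: x y) (simp_all add: T(2) funpow_swap1[of "blinfun_apply T"])
  ultimately show ?thesis
    by (simp add: selfadjoint_iff bounded_operators_def op_power_apply)
qed

lemma positive_operator_selfadjoint: "positive_operator A \<Longrightarrow> selfadjoint A"
  by (simp add: positive_operator_def op_le_def)

lemma positive_operator_pos_map: "positive_operator A \<Longrightarrow> pos_map (blinfun_apply A)"
  by (auto simp: positive_operator_def op_le_iff selfadjoint_iff pos_map_def rinner_def
      blinfun.bounded_linear_right cinner_scaleR_left[of 0 0, simplified])

lemma unitaryD:
  assumes "U \<in> unitary_operators"
  shows "U \<in> bounded_operators" "adj U (U x) = x" "U (adj U x) = x"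
    "cinner (U x) y = cinner x (adj U y)" "adj U \<in> bounded_operators"
    "norm (blinfun_apply U x) = norm x"
proof -
  have U: "U \<in> bounded_operators" "adj U o\<^sub>L U = id_blinfun" "U o\<^sub>L adj U = id_blinfun"
    using assms by (auto simp: unitary_operators_def)
  show "U \<in> bounded_operators" by fact
  show inv: "adj U (U x) = x" for x
    using arg_cong[OF U(2), of "\<lambda>T. blinfun_apply T x"] by simp
  show "U (adj U x) = x"
    using arg_cong[OF U(3), of "\<lambda>T. blinfun_apply T x"] by simp
  show adj: "cinner (U x) y = cinner x (adj U y)" for x y
    by (rule adj_spec[OF U(1)])
  show "adj U \<in> bounded_operators"
    by (rule adj_spec[OF U(1)])
  have "cinner (U x) (U x) = cinner x x"
    by (simp add: adj inv)
  then show "norm (blinfun_apply U x) = norm x"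
    by (simp add: cinner_self del: of_real_power)
qed

lemma unitary_compose:
  assumes U: "U \<in> unitary_operators" and V: "V \<in> unitary_operators"
  shows "U o\<^sub>L V \<in> unitary_operators"
proof -
  have bo: "U o\<^sub>L V \<in> bounded_operators"
    by (intro bounded_operators_compose unitaryD(1) U V)
  have "adj (U o\<^sub>L V) = adj V o\<^sub>L adj U"
    by (rule adj_eqI[OF bo]) (simp add: unitaryD(4)[OF U] unitaryD(4)[OF V])
  then show ?thesis
    using bo by (auto simp: unitary_operators_def unitaryD[OF U] unitaryD[OF V] intro!: blinfun_eqI)
qed

lemma selfadjoint_conj:
  assumes U: "U \<in> unitary_operators" and T: "selfadjoint T"
  shows "selfadjoint (adj U o\<^sub>L T o\<^sub>L U)"
proof -
  have adj: "cinner (adj U x) y = cinner x (U y)" for x y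
    by (metis cinner_commute unitaryD(4)[OF U])
  show ?thesis
    using T by (auto simp: selfadjoint_iff adj unitaryD(4)[OF U] bounded_operatorsD
        intro!: bounded_operators_compose unitaryD(1)[OF U] unitaryD(5)[OF U])
qed

text \<open>Moving \<open>adj U\<close> across the inner product turns membership into a comparison
  of forms at \<open>x\<close> and \<open>U x\<close>.\<close>

lemma K_set_iff:
  assumes "positive_operator A" and "positive_operator B"
  shows "U \<in> K_set n A B \<longleftrightarrow> U \<in> unitary_operators
    \<and> (\<forall>x. rinner ((blinfun_apply A ^^ n) x) x \<le> rinner ((blinfun_apply B ^^ n) (U x)) (U x))"
proof -
  have sa: "selfadjoint (op_power A n)" "selfadjoint (op_power B n)"
    using assms by (auto intro: selfadjoint_op_power positive_operator_selfadjoint)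
  have "rinner ((adj U o\<^sub>L op_power B n o\<^sub>L U) x) x = rinner ((blinfun_apply B ^^ n) (U x)) (U x)"
    if U: "U \<in> unitary_operators" for x
  proof -
    have "cinner (adj U z) x = cinner z (U x)" for z
      by (metis cinner_commute unitaryD(4)[OF U])
    then show ?thesis by (simp add: rinner_def op_power_apply)
  qed
  then show ?thesis
    using sa selfadjoint_conj by (auto simp: K_set_def op_le_iff op_power_apply)
qed

section \<open>Conjugation of positive maps by a unitary\<close>

lemma rinner_adj_left:
  assumes U: "U \<in> unitary_operators"
  shows "rinner (adj U x) y = rinner x (U y)"
  unfolding rinner_def by (metis cinner_commute unitaryD(4)[OF U])

lemma pos_map_conj:
  assumes U: "U \<in> unitary_operators" and B: "pos_map B"
  shows "pos_map (\<lambda>x. adj U (B (U x)))"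
proof -
  note adj_left = rinner_adj_left[OF U]
  have adj_right: "rinner (U x) y = rinner x (adj U y)" for x y
    by (metis rinner_commute adj_left)
  have "bounded_linear (\<lambda>x. adj U (B (U x)))"
    by (intro blinfun.bounded_linear_right bounded_linear_compose[OF blinfun.bounded_linear_right]
        bounded_linear_compose[OF pos_mapD(1)[OF B]])
  then show ?thesis
    using pos_mapD(2,3)[OF B] by (simp add: pos_map_def adj_left) (simp add: adj_right)
qed

lemma funpow_conj:
  assumes U: "U \<in> unitary_operators"
  shows "((\<lambda>x. adj U (B (U x))) ^^ n) x = adj U ((B ^^ n) (U x))"
  by (induction n) (simp_all add: unitaryD[OF U])

text \<open>The difference is itself a positive map with zero form, so Cauchy-Schwarz kills all its
  coefficients.\<close>

lemma pos_map_eqI: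
  assumes A: "pos_map A" and B: "pos_map B" and eq: "\<And>x. rinner (A x) x = rinner (B x) x"
  shows "A x = B x"
proof (rule rinner_eqI)
  fix y
  have "pos_map (\<lambda>x. A x - B x)"
    using A B eq unfolding pos_map_def
    by (auto simp: rinner_diff_left rinner_diff_right intro: bounded_linear_sub)
  from pos_map_cauchy_schwarz[OF this, of x y] have "rinner (A x - B x) y = 0"
    by (simp add: rinner_diff_left eq)
  then show "rinner y (A x) = rinner y (B x)"
    by (simp add: rinner_diff_left rinner_commute[of y])
qed

section \<open>Cluster points of sequences of unitary operators\<close>

text \<open>Cluster points are recorded as limits along a finer filter instead of subsequences,
  since compactness here need not be sequential.\<close>

lemma compact_cluster_filter:
  fixes f :: "nat \<Rightarrow> 'a::topological_space"
  assumes S: "compact S" and f: "\<And>k. f k \<in> S"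
  obtains l G where "l \<in> S" "G \<noteq> bot" "G \<le> sequentially" "(f \<longlongrightarrow> l) G"
proof -
  have "filtermap f sequentially \<noteq> bot" "eventually (\<lambda>x. x \<in> S) (filtermap f sequentially)"
    using f by (auto simp: filtermap_bot_iff eventually_filtermap)
  then obtain l where l: "l \<in> S" "inf (nhds l) (filtermap f sequentially) \<noteq> bot"
    using S unfolding compact_filter by blast
  define G where "G = inf (filtercomap f (nhds l)) sequentially"
  have "G \<noteq> bot"
  proof
    assume "G = bot"
    then obtain P Q where PQ: "eventually P (filtercomap f (nhds l))" "eventually Q sequentially"
        "\<And>k. P k \<Longrightarrow> Q k \<Longrightarrow> False"
      by (auto simp: G_def trivial_limit_def eventually_inf)
    obtain R where R: "eventually R (nhds l)" "\<And>k. R (f k) \<Longrightarrow> P k"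
      using PQ(1) by (auto simp: eventually_filtercomap)
    have "eventually (\<lambda>y. \<not> R y) (filtermap f sequentially)"
      unfolding eventually_filtermap using PQ(2) by (rule eventually_mono) (use PQ(3) R(2) in blast)
    then have "eventually (\<lambda>y. False) (inf (nhds l) (filtermap f sequentially))"
      using R(1) unfolding eventually_inf by blast
    then show False
      using l(2) by (simp add: trivial_limit_def)
  qed
  moreover have "G \<le> sequentially" "(f \<longlongrightarrow> l) G"
    by (simp_all add: G_def filterlim_iff_le_filtercomap)
  ultimately show ?thesis
    using l(1) that by blast
qed

lemma tendsto_coordinate:
  fixes f :: "'i \<Rightarrow> 'b \<Rightarrow> 'c::topological_space"
  assumes "(f \<longlongrightarrow> l) G"
  shows "((\<lambda>k. f k x) \<longlongrightarrow> l x) G"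
proof (rule topological_tendstoI)
  fix U :: "'c set" assume U: "open U" "l x \<in> U"
  have "open ((\<lambda>g :: 'b \<Rightarrow> 'c. g x) -` U)"
    by (rule open_vimage[OF U(1)]) simp
  from topological_tendstoD[OF assms this] U(2) show "\<forall>\<^sub>F k in G. f k x \<in> U"
    by simp
qed

text \<open>Limits of the coefficients of contractions form a bounded sesquilinear form, which Riesz
  representation turns into an operator.\<close>

lemma weak_limit_operator:
  fixes T :: "'i \<Rightarrow> 'a::complex_hilbert_space \<Rightarrow>\<^sub>L 'a"
  assumes G: "G \<noteq> bot" and T: "\<And>k. T k \<in> bounded_operators"
    and contraction: "\<And>k x. norm (T k x) \<le> norm x"
    and lim: "\<And>x y. ((\<lambda>k. cinner (T k x) y) \<longlongrightarrow> f x y) G"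
  shows "\<exists>S\<in>bounded_operators. \<forall>x y. f x y = cinner (blinfun_apply S x) y"
proof -
  note uniq = tendsto_unique[OF G lim]
  have add_left: "f (x + x') y = f x y + f x' y" for x x' y
    using tendsto_add[OF lim[of x y] lim[of x' y]]
    by (intro uniq) (simp add: blinfun.add_right cinner_add_left)
  have add_right: "f x (y + y') = f x y + f x y'" for x y y'
    using tendsto_add[OF lim[of x y] lim[of x y']]
    by (intro uniq) (simp add: cinner_add_right)
  have scale_left: "f (a *\<^sub>C x) y = a * f x y" for a x y
    using tendsto_mult[OF tendsto_const lim[of x y], of a]
    by (intro uniq) (simp add: bounded_operatorsD[OF T] cinner_scaleC_left)
  have scale_right: "f x (a *\<^sub>C y) = cnj a * f x y" for a x y
    using tendsto_mult[OF tendsto_const lim[of x y], of "cnj a"]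
    by (intro uniq) (simp add: cinner_scaleC_right)
  have bound: "\<bar>Re (f x y)\<bar> \<le> norm x * norm y" for x y
  proof (rule tendsto_upperbound[OF _ _ G])
    show "((\<lambda>k. \<bar>Re (cinner (T k x) y)\<bar>) \<longlongrightarrow> \<bar>Re (f x y)\<bar>) G"
      by (intro tendsto_intros lim)
    have "\<bar>Re (cinner (T k x) y)\<bar> \<le> norm x * norm y" for k
      using order_trans[OF cinner_cauchy_schwarz_Re mult_right_mono[OF contraction norm_ge_zero]] .
    then show "\<forall>\<^sub>F k in G. \<bar>Re (cinner (T k x) y)\<bar> \<le> norm x * norm y"
      by simp
  qed
  have "bounded_linear (\<lambda>y. Re (f x y))" for x
  proof (rule bounded_linear_intro[where K = "norm x"])
    show "Re (f x (r *\<^sub>R y)) = r *\<^sub>R Re (f x y)" for r y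
      using scale_right[of x "complex_of_real r" y] by (simp add: scaleC_of_real)
    show "norm (Re (f x y)) \<le> norm y * norm x" for y
      using bound[of x y] by (simp add: mult.commute)
  qed (simp add: add_right)
  then have "\<forall>x. \<exists>z. \<forall>y. Re (f x y) = Re (cinner y z)"
    using riesz_real by blast
  then obtain s where s': "\<And>x y. Re (f x y) = Re (cinner y (s x))"
    by metis
  have s: "Re (f x y) = Re (cinner (s x) y)" for x y
    using s' rinner_commute[of "s x" y] by (simp add: rinner_def)
  have f: "f x y = cinner (s x) y" for x y
  proof (rule complex_eqI)
    \<comment> \<open>\<open>f\<close> is conjugate-linear in its second argument, so the imaginary
      part is reached by scaling that argument by \<open>- \<i>\<close>.\<close>
    have Im: "Im w = - Re (cnj (- \<i>) * w)" for w
      by simp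
    show "Im (f x y) = Im (cinner (s x) y)"
      unfolding Im scale_right[symmetric] cinner_scaleC_right[symmetric] by (simp only: s)
  qed (rule s)
  have add: "s (x + y) = s x + s y" for x y
    by (rule cinner_eqI_left) (simp add: cinner_add_left f[symmetric] add_left)
  have scC: "s (c *\<^sub>C x) = c *\<^sub>C s x" for c x
    by (rule cinner_eqI_left) (simp add: cinner_scaleC_left f[symmetric] scale_left)
  have "bounded_linear s"
  proof (rule bounded_linear_intro[where K = 1])
    fix x
    have "norm (s x) * norm (s x) \<le> norm x * norm (s x)"
      using bound[of x "s x"] by (simp add: f cinner_self power2_eq_square)
    then show "norm (s x) \<le> norm x * 1"
      by (cases "norm (s x) = 0") (auto simp: mult_le_cancel_right)
    show "s (r *\<^sub>R x) = r *\<^sub>R s x" for r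
      using scC[of "complex_of_real r" x] by (simp add: scaleC_of_real)
  qed (rule add)
  then have "blinfun_apply (Blinfun s) = s"
    by (rule bounded_linear_Blinfun_apply)
  then show ?thesis
    by (intro bexI[of _ "Blinfun s"]) (auto simp: bounded_operators_def scC f)
qed

text \<open>As norms are preserved, the squared distance of \<open>T k x\<close> and
  \<open>S x\<close> depends only on the coefficient at \<open>x\<close> and
  \<open>S x\<close>.\<close>

lemma weak_limit_unitary_imp_strong:
  assumes T: "\<And>k. T k \<in> unitary_operators" and S: "S \<in> unitary_operators"
    and lim: "\<And>x y. ((\<lambda>k. cinner (blinfun_apply (T k) x) y) \<longlongrightarrow> cinner (S x) y) G"
  shows "((\<lambda>k. T k x) \<longlongrightarrow> S x) G"
proof -
  have "((\<lambda>k. 2 * (norm x)\<^sup>2 - 2 * Re (cinner (T k x) (S x)))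
      \<longlongrightarrow> 2 * (norm x)\<^sup>2 - 2 * Re (cinner (S x) (S x))) G"
    by (intro tendsto_intros lim)
  moreover have "(norm (T k x - S x))\<^sup>2 = 2 * (norm x)\<^sup>2 - 2 * Re (cinner (T k x) (S x))" for k
    unfolding norm_diff_square rinner_def by (simp add: unitaryD(6)[OF T] unitaryD(6)[OF S])
  ultimately have "((\<lambda>k. (norm (T k x - S x))\<^sup>2) \<longlongrightarrow> 0) G"
    by (simp add: cinner_self unitaryD(6)[OF S])
  from tendsto_real_sqrt[OF this] have "((\<lambda>k. norm (T k x - S x)) \<longlongrightarrow> 0) G"
    by simp
  then show ?thesis
    by (simp add: tendsto_norm_zero_iff LIM_zero_iff)
qed

text \<open>By Tychonoff the coefficient functions have a cluster point; closedness puts its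
  operator into \<open>K\<close>, so it is unitary and the convergence is strong.\<close>

lemma closedin_WOT_cluster:
  fixes T :: "nat \<Rightarrow> 'a::complex_hilbert_space \<Rightarrow>\<^sub>L 'a"
  assumes K: "closedin WOT K" "K \<subseteq> unitary_operators" and T: "\<And>k. T k \<in> K"
  obtains S G where "S \<in> K" "G \<noteq> bot" "G \<le> sequentially" "\<And>x. ((\<lambda>k. T k x) \<longlongrightarrow> S x) G"
proof -
  define c where "c T = (\<lambda>(x, y). cinner (blinfun_apply T x) y)" for T :: "'a \<Rightarrow>\<^sub>L 'a"
  \<comment> \<open>The factor 2 comes from bounding real and imaginary parts separately.\<close>
  define E where "E = PiE UNIV (\<lambda>(x::'a, y::'a). cball (0::complex) (2 * (norm x * norm y)))"
  have "compactin (product_topology (\<lambda>_. euclidean) UNIV) E"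
    unfolding E_def by (subst compactin_PiE) auto
  then have "compact E"
    by (simp add: euclidean_product_topology)
  note Tu = subsetD[OF K(2) T]
  have "norm (cinner (T k x) y) \<le> 2 * (norm x * norm y)" for k x y
  proof -
    have "\<bar>Re (cinner (T k x) y)\<bar> \<le> norm x * norm y"
      using cinner_cauchy_schwarz_Re[of "T k x" y] by (simp add: unitaryD(6)[OF Tu])
    moreover have "\<bar>Im (cinner (T k x) y)\<bar> \<le> norm x * norm y"
    proof -
      have "norm (\<i> *\<^sub>C T k x) = norm (T k x)"
      proof -
        have "cinner (\<i> *\<^sub>C T k x) (\<i> *\<^sub>C T k x) = cinner (T k x) (T k x)"
          by (simp add: cinner_scaleC_left cinner_scaleC_right)
        then show ?thesis
          by (simp add: cinner_self del: of_real_power)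
      qed
      then show ?thesis
        using cinner_cauchy_schwarz_Re[of "\<i> *\<^sub>C T k x" y]
        by (simp add: cinner_scaleC_left unitaryD(6)[OF Tu])
    qed
    ultimately show ?thesis
      using cmod_le[of "cinner (T k x) y"] by linarith
  qed
  then have "\<And>k. c (T k) \<in> E"
    by (auto simp: E_def c_def)
  with \<open>compact E\<close> obtain l G where "l \<in> E" and G: "G \<noteq> bot" "G \<le> sequentially"
    and l: "((\<lambda>k. c (T k)) \<longlongrightarrow> l) G"
    by (rule compact_cluster_filter)
  have lim: "((\<lambda>k. cinner (T k x) y) \<longlongrightarrow> l (x, y)) G" for x y
    using tendsto_coordinate[OF l, of "(x, y)"] by (simp add: c_def)
  obtain S where S: "S \<in> bounded_operators" "\<And>x y. l (x, y) = cinner (S x) y"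
    using weak_limit_operator[OF G(1) unitaryD(1)[OF Tu] eq_refl[OF unitaryD(6)[OF Tu]] lim]
    by blast
  have "S \<in> K"
  proof (rule ccontr)
    assume "S \<notin> K"
    \<comment> \<open>If \<open>S\<close> lay outside \<open>K\<close>, an open set of coefficient
      functions would eventually drive \<open>T k\<close> out of \<open>K\<close> too.\<close>
    have "openin WOT (topspace WOT - K)"
      using K(1) by blast
    then obtain N where N: "open N" "topspace WOT - K = c -` N \<inter> bounded_operators"
      unfolding WOT_def openin_pullback_topology c_def by auto
    have "S \<in> topspace WOT"
      using S(1) by (simp add: WOT_def topspace_pullback_topology)
    then have "c S \<in> N"
      using N(2) \<open>S \<notin> K\<close> by blast
    moreover have "c S = l"
      using S(2) by (auto simp: c_def)
    ultimately have "\<forall>\<^sub>F k in G. c (T k) \<in> N"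
      using topological_tendstoD[OF l N(1)] by simp
    then have "\<forall>\<^sub>F k in G. False"
    proof (rule eventually_mono)
      fix k assume "c (T k) \<in> N"
      then have "T k \<in> topspace WOT - K"
        using N(2) unitaryD(1)[OF Tu] by blast
      then show False using T by blast
    qed
    then show False using G(1) by simp
  qed
  moreover have "((\<lambda>k. T k x) \<longlongrightarrow> S x) G" for x
    using lim K(2) \<open>S \<in> K\<close> by (intro weak_limit_unitary_imp_strong Tu) (auto simp: S(2))
  ultimately show ?thesis
    using G that by blast
qed

text \<open>The strong topology is pulled back from the product topology along
  \<open>blinfun_apply\<close>, so the image of \<open>K\<close> is a compact set of
  functions.\<close>

lemma compactin_SOT_cluster:
  fixes T :: "nat \<Rightarrow> 'a::complex_hilbert_space \<Rightarrow>\<^sub>L 'a"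
  assumes K: "compactin SOT K" and T: "\<And>k. T k \<in> K"
  obtains S G where "S \<in> K" "G \<noteq> bot" "G \<le> sequentially" "\<And>x. ((\<lambda>k. T k x) \<longlongrightarrow> S x) G"
proof -
  have "continuous_map strong_operator_topology euclidean (id \<circ> blinfun_apply)"
    unfolding strong_operator_topology_def by (rule continuous_map_pullback) simp
  moreover have "compactin strong_operator_topology K"
    using K by (simp add: SOT_def compactin_subtopology)
  ultimately have "compact (blinfun_apply ` K)"
    using image_compactin by fastforce
  moreover have "\<And>k. blinfun_apply (T k) \<in> blinfun_apply ` K"
    using T by (rule imageI)
  ultimately obtain l G where l: "l \<in> blinfun_apply ` K"
    and G: "G \<noteq> bot" "G \<le> sequentially"
    and lim: "((\<lambda>k. blinfun_apply (T k)) \<longlongrightarrow> l) G"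
    by (rule compact_cluster_filter)
  from l obtain S where S: "S \<in> K" "l = blinfun_apply S"
    by blast
  have "((\<lambda>k. T k x) \<longlongrightarrow> S x) G" for x
    using tendsto_coordinate[OF lim] S(2) by simp
  then show ?thesis
    using S(1) G that by blast
qed

section \<open>Unitary equivalence\<close>

text \<open>The form of \<open>C\<close> increases along the orbits of the isometry \<open>W\<close>; a cluster point \<open>X\<close> of the
  powers of \<open>W\<close> commutes with \<open>W\<close>, and the limit of the form along the orbit of \<open>x\<close> is its value
  at \<open>X x\<close> as well as at \<open>X (W x) = W (X x)\<close>. So the form is constant along the orbits that
  start in the range of \<open>X\<close>.\<close>

lemma form_invariant_of_cluster:
  assumes C: "pos_map C" and W: "bounded_linear W" "\<And>x. norm (W x) = norm x"
    and incr: "\<And>x. rinner (C x) x \<le> rinner (C (W x)) (W x)"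
    and G: "G \<noteq> bot" "G \<le> sequentially" and lim: "\<And>x. ((\<lambda>k. (W ^^ k) x) \<longlongrightarrow> X x) G"
    and surj: "surj X"
  shows "rinner (C (W y)) (W y) = rinner (C y) y"
proof -
  define q where "q x = rinner (C x) x" for x
  obtain x where x: "y = X x"
    using surj by (rule surjE)
  \<comment> \<open>The orbit stays on a sphere, so the increasing values of the form are bounded
    and converge.\<close>
  have norm_pow: "norm ((W ^^ k) x) = norm x" for k
    by (induction k) (simp_all add: W(2))
  obtain M where M: "\<And>x. norm (C x) \<le> norm x * M"
    using bounded_linear.bounded[OF pos_mapD(1)[OF C]] by blast
  have "q ((W ^^ k) x) \<le> norm x * M * norm x" for k
  proof -
    have "q ((W ^^ k) x) \<le> norm (C ((W ^^ k) x)) * norm ((W ^^ k) x)"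
      using abs_rinner_le[of "C ((W ^^ k) x)" "(W ^^ k) x"] by (simp add: q_def)
    also have "\<dots> \<le> norm x * M * norm x"
      using mult_right_mono[OF M[of "(W ^^ k) x"] norm_ge_zero] by (simp add: norm_pow)
    finally show ?thesis .
  qed
  moreover have "incseq (\<lambda>k. q ((W ^^ k) x))"
    using incr by (intro incseq_SucI) (simp add: q_def)
  ultimately obtain L where L: "(\<lambda>k. q ((W ^^ k) x)) \<longlonglongrightarrow> L"
    using incseq_convergent by blast
  have q_lim: "((\<lambda>k. q (Y k)) \<longlongrightarrow> q Z) G" if "(Y \<longlongrightarrow> Z) G" for Y Z
    unfolding q_def using that
    by (intro tendsto_rinner bounded_linear.tendsto[OF pos_mapD(1)[OF C]])
  have "q (X x) = L"
    using tendsto_unique[OF G(1) q_lim[OF lim] tendsto_mono[OF G(2) L]] .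
  moreover have "q (W (X x)) = L"
  proof (rule tendsto_unique[OF G(1)])
    show "((\<lambda>k. q (W ((W ^^ k) x))) \<longlongrightarrow> q (W (X x))) G"
      by (intro q_lim bounded_linear.tendsto[OF W(1)] lim)
    show "((\<lambda>k. q (W ((W ^^ k) x))) \<longlongrightarrow> L) G"
      using tendsto_mono[OF G(2) LIMSEQ_Suc[OF L]] by simp
  qed
  ultimately show ?thesis by (simp add: q_def x)
qed

text \<open>The core for ordered exponents: the comparison is lowered from \<open>n\<close> to
  \<open>p\<close>, made an equality there, and then reduced to exponent 1.\<close>

lemma K_sets_imp_form_eq:
  fixes A B :: "'a::complex_hilbert_space \<Rightarrow>\<^sub>L 'a"
  assumes A: "positive_operator A" and B: "positive_operator B" and p: "0 < p" "p \<le> n"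
    and U: "U \<in> K_set n A B" and V: "V \<in> K_set p B A"
    and K: "compactin SOT (K_set p B A) \<or> closedin WOT (K_set p B A)"
  shows "rinner (A x) x = rinner (B (U x)) (U x)"
proof -
  note Am = positive_operator_pos_map[OF A] and Bm = positive_operator_pos_map[OF B]
  define q where "q x = rinner ((blinfun_apply A ^^ p) x) x" for x
  define r where "r x = rinner ((blinfun_apply B ^^ p) x) x" for x
  have Uu: "U \<in> unitary_operators"
    and U_le: "\<And>x. rinner ((blinfun_apply A ^^ n) x) x \<le> rinner ((blinfun_apply B ^^ n) (U x)) (U x)"
    using U by (auto simp: K_set_iff[OF A B])
  define D where "D x = adj U (B (U x))" for x
  have D: "pos_map D"
    unfolding D_def by (rule pos_map_conj[OF Uu Bm])
  have D_pow: "rinner ((D ^^ k) x) x = rinner ((blinfun_apply B ^^ k) (U x)) (U x)" for k x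
    unfolding D_def funpow_conj[OF Uu] by (rule rinner_adj_left[OF Uu])
  have q_le: "q x \<le> r (U x)" for x
    using power_le_imp_power_le[OF Am D _ p(2), where x = x] U_le
    by (simp add: D_pow q_def r_def)
  have K_iff: "T \<in> K_set p B A \<longleftrightarrow> T \<in> unitary_operators \<and> (\<forall>x. r x \<le> q (T x))" for T
    by (simp add: K_set_iff[OF B A] q_def r_def)
  have Vu: "V \<in> unitary_operators" and r_le: "\<And>x. r x \<le> q (V x)"
    using V by (auto simp: K_iff)
  define W where "W = V o\<^sub>L U"
  have Wu: "W \<in> unitary_operators"
    unfolding W_def by (rule unitary_compose[OF Vu Uu])
  have incr: "q x \<le> q (W x)" for x
    using order_trans[OF q_le r_le] by (simp add: W_def)
  \<comment> \<open>The factor \<open>V\<close> starts the sequence inside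
    \<open>K_set p B A\<close>, and \<open>incr\<close> keeps it there.\<close>
  define T where "T k = ((o\<^sub>L) W ^^ k) V" for k
  have T_apply: "T k x = (blinfun_apply W ^^ k) (V x)" for k x
    by (induction k) (simp_all add: T_def)
  have T_in: "T k \<in> K_set p B A" for k
  proof (induction k)
    case 0
    then show ?case using V by (simp add: T_def)
  next
    case (Suc k)
    have "T (Suc k) = W o\<^sub>L T k"
      by (simp add: T_def)
    then show ?case
      using Suc unitary_compose[OF Wu] order_trans[OF _ incr] by (simp add: K_iff)
  qed
  have Ku: "K_set p B A \<subseteq> unitary_operators"
    by (auto simp: K_iff)
  obtain S G where S: "S \<in> K_set p B A" and G: "G \<noteq> bot" "G \<le> sequentially"
    and lim: "\<And>x. ((\<lambda>k. T k x) \<longlongrightarrow> S x) G"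
    using K
  proof
    assume "compactin SOT (K_set p B A)"
    from compactin_SOT_cluster[OF this T_in] show ?thesis using that .
  next
    assume "closedin WOT (K_set p B A)"
    from closedin_WOT_cluster[OF this Ku T_in] show ?thesis using that .
  qed
  have Su: "S \<in> unitary_operators"
    using S Ku by blast
  have q_W: "q (W y) = q y" for y
    unfolding q_def
  proof (rule form_invariant_of_cluster[OF pos_map_funpow[OF Am] blinfun.bounded_linear_right
        unitaryD(6)[OF Wu] _ G])
    \<comment> \<open>Evaluating at \<open>adj V x\<close> strips off \<open>V\<close> and leaves
      the pure powers of \<open>W\<close>.\<close>
    show "((\<lambda>k. (blinfun_apply W ^^ k) x) \<longlongrightarrow> S (adj V x)) G" for x
      using lim[of "adj V x"] by (simp add: T_apply unitaryD(3)[OF Vu])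
    show "surj (\<lambda>x. S (adj V x))"
      by (rule surjI[of _ "\<lambda>y. V (adj S y)"]) (simp add: unitaryD(2)[OF Vu] unitaryD(3)[OF Su])
  qed (use incr in \<open>simp add: q_def\<close>)
  \<comment> \<open>Squeeze: \<open>q x \<le> r (U x) \<le> q (W x) = q x\<close>.\<close>
  have q_eq: "q x = r (U x)" for x
    using q_le[of x] r_le[of "U x"] q_W[of x] by (simp add: W_def)
  have "rinner ((blinfun_apply A ^^ 1) x) x \<le> rinner ((D ^^ 1) x) x"
    by (rule power_le_imp_power_le[OF Am D, of p]) (use q_eq p in \<open>simp_all add: D_pow q_def r_def\<close>)
  moreover have "rinner ((D ^^ 1) x) x \<le> rinner ((blinfun_apply A ^^ 1) x) x"
    by (rule power_le_imp_power_le[OF D Am, of p]) (use q_eq p in \<open>simp_all add: D_pow q_def r_def\<close>)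
  ultimately show ?thesis
    using D_pow[of 1 x] by simp
qed

lemma form_eq_imp_conj:
  assumes A: "positive_operator A" and B: "positive_operator B" and U: "U \<in> unitary_operators"
    and eq: "\<And>x. rinner (A x) x = rinner (B (U x)) (U x)"
  shows "A = adj U o\<^sub>L B o\<^sub>L U"
proof (rule blinfun_eqI)
  fix x
  have "A x = adj U (B (U x))"
    by (rule pos_map_eqI[OF positive_operator_pos_map[OF A]
          pos_map_conj[OF U positive_operator_pos_map[OF B]]])
      (simp add: eq rinner_adj_left[OF U])
  then show "A x = (adj U o\<^sub>L B o\<^sub>L U) x" by simp
qed

lemma unitarily_equivalent_sym:
  assumes "unitarily_equivalent A B"
  shows "unitarily_equivalent B A"
proof -
  obtain W where W: "W \<in> unitary_operators" and A: "A = adj W o\<^sub>L B o\<^sub>L W"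
    using assms by (auto simp: unitarily_equivalent_def)
  have adj_adj: "adj (adj W) = W"
    by (rule adj_eqI[OF unitaryD(5)[OF W]]) (metis cinner_commute unitaryD(4)[OF W])
  then have "adj W \<in> unitary_operators"
    using W unitaryD(5)[OF W] by (simp add: unitary_operators_def)
  moreover have "B = adj (adj W) o\<^sub>L A o\<^sub>L adj W"
    by (rule blinfun_eqI) (simp add: adj_adj A unitaryD(3)[OF W])
  ultimately show ?thesis
    unfolding unitarily_equivalent_def by blast
qed

theorem corollary2p15:
  fixes A B :: "'a::complex_hilbert_space \<Rightarrow>\<^sub>L 'a"
    and n\<^sub>0 m\<^sub>0 :: nat
  assumes "positive_operator A" and "positive_operator B"
    and "n\<^sub>0 > 0" and "m\<^sub>0 > 0"
    and "K_set n\<^sub>0 A B \<noteq> {}" and "K_set m\<^sub>0 B A \<noteq> {}"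
    and "compactin SOT (K_set n\<^sub>0 A B) \<or> closedin WOT (K_set n\<^sub>0 A B)"
    and "compactin SOT (K_set m\<^sub>0 B A) \<or> closedin WOT (K_set m\<^sub>0 B A)"
  shows "unitarily_equivalent A B"
proof -
  have *: "unitarily_equivalent C D"
    if C: "positive_operator C" and D: "positive_operator D" and p: "0 < p" "p \<le> n"
      and ne: "K_set n C D \<noteq> {}" "K_set p D C \<noteq> {}"
      and K: "compactin SOT (K_set p D C) \<or> closedin WOT (K_set p D C)"
    for C D :: "'a \<Rightarrow>\<^sub>L 'a" and n p
  proof -
    obtain U V where U: "U \<in> K_set n C D" and V: "V \<in> K_set p D C"
      using ne by blast
    then have Uu: "U \<in> unitary_operators"
      by (simp add: K_set_def)
    show ?thesis
      using form_eq_imp_conj[OF C D Uu K_sets_imp_form_eq[OF C D p U V K]] Uu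
      unfolding unitarily_equivalent_def by blast
  qed
  show ?thesis
    \<comment> \<open>The smaller exponent must play the role of \<open>p\<close>; if that is
      \<open>n\<^sub>0\<close>, the operators are swapped and the equivalence is inverted.\<close>
    using *[of A B m\<^sub>0 n\<^sub>0] *[of B A n\<^sub>0 m\<^sub>0] assms
    by (cases "m\<^sub>0 \<le> n\<^sub>0") (auto intro: unitarily_equivalent_sym)
qed

end
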